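(* Let $G$ be an abelian group which is free of 2-torsion, $g_0\in G$, and let $\mathcal P=\bigoplus_{g\in G}\mathcal P_g$ be a Poisson color algebra of degree $g_0$ over a field $\mathbb K$, with restricted support $\Sigma$. Suppose that $\mathcal P_\alpha$ is tight for every $\alpha\in\{0,g_0,-g_0\}$. Then the following assertions hold. 1. For any $g\in\Sigma$, $\mathcal I_{[g]}$ is an ideal of $\mathcal P$. 2. If $\mathcal P$ is simple, then there exists a connection between any two elements of $\Sigma$ (that is, any two elements of $\Sigma$ are connected).
   Context: $\mathbb K$ is an arbitrary field, $(G,+)$ an abelian group; all algebras have arbitrary dimension. "Free of 2-torsion" means $2x=0$ implies $x=0$ in $G$. A skew-symmetric bicharacter of $G$ is a map $\epsilon:G\times G\to\mathbb K\setminus\{0\}$ with $\epsilon(a,b)=\epsilon(b,a)^{-1}$ and $\epsilon(a,b+c)=\epsilon(a,b)\epsilon(a,c)$. Poisson color algebra of degree $g_0\in G$ (with respect to $\epsilon$): a $G$-graded $\mathbb K$-vector space $\mathcal P=\bigoplus_{g\in G}\mathcal P_g$ with a bilinear product $\{\cdot,\cdot\}$ satisfying $\{\mathcal P_g,\mathcal P_h\}\subset\mathcal P_{g+h+g_0}$ and, for homogeneous $x,y,z$ of degrees $|x|,|y|,|z|$, $\{x,y\}=-\epsilon(|x|+g_0,|y|+g_0)\{y,x\}$ and $\{x,\{y,z\}\}=\{\{x,y\},z\}+\epsilon(|x|+g_0,|y|+g_0)\{y,\{x,z\}\}$; together with a bilinear associative product (juxtaposition) satisfying $\mathcal P_g\mathcal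 P_h\subset\mathcal P_{g+h}$, $xy=\epsilon(|x|,|y|)yx$ and $\{x,yz\}=\{x,y\}z+\epsilon(|x|+g_0,|y|)y\{x,z\}$ for homogeneous $x,y,z$. Products $\{A,B\}$ and $AB$ of subspaces denote linear spans of products of elements. A subalgebra is a graded linear subspace $\mathcal Q$ with $\{\mathcal Q,\mathcal Q\}+\mathcal Q\mathcal Q\subset\mathcal Q$; an ideal is a subalgebra $\mathcal I$ (in particular graded) with $\{\mathcal I,\mathcal P\}+\{\mathcal P,\mathcal I\}+\mathcal I\mathcal P+\mathcal P\mathcal I\subset\mathcal I$. $\mathcal P$ is simple if $\{\mathcal P,\mathcal P\}\neq0$, $\mathcal P\mathcal P\neq0$ and its only ideals are $\{0\}$ and $\mathcal P$. Restricted support: $\Sigma=\{g\in G:\mathcal P_g\neq0\}\setminus\{0,\pm g_0\}$; $-\Sigma=\{-g:g\in\Sigma\}$, $\pm\Sigma=\Sigma\cup(-\Sigma)$. Connection: for $g,h\in\Sigma$, $g$ is connected to $h$ if there exist $n\ge1$, $g_1,\dots,g_n\in\pm\Sigma\cup\{0,\pm g_0\}$ and $k_2,\dots,k_n\in\{0,\pm g_0\}$ such that $g_1=g$; for each $2\le m\le n-1$, $g_1+(g_2+k_2)+\cdots+(g_m+k_m)\in\pm\Sigma$; and $g_1+(g_2+k_2)+\cdots+(g_n+k_n)\in\{h,-h\}$. The relation $g\sim h$ iff $g$ is connected to $h$ is an equivalence relation on $\Sigma$; $[g]$ is the class of $g$. For $g\in\Sigma$ and $\alpha\in\{0,g_0,-g_0\}$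 put $$\mathcal P_{\alpha,[g]}=\sum_{\substack{h\in[g],\,p\in\Sigma\\ p=-h-g_0+\alpha}}\{\mathcal P_h,\mathcal P_p\}+\sum_{\substack{k\in[g],\,q\in\Sigma\cup\{-g_0\}\\ q=-k+\alpha}}\mathcal P_k\mathcal P_q\subset\mathcal P_\alpha,$$ $\mathcal V_{[g]}=\bigoplus_{h\in[g]}\mathcal P_h$, and $\mathcal I_{[g]}=\Big(\sum_{\alpha\in\{0,g_0,-g_0\}}\mathcal P_{\alpha,[g]}\Big)\oplus\mathcal V_{[g]}$. Tightness: for $\alpha\in\{\pm ng_0:n=0,1,2,3\}$, $\mathcal P_\alpha$ is tight if, with $\Sigma'=\Sigma\setminus\{\pm2g_0,\pm3g_0\}$, $$\mathcal P_\alpha=\sum_{\substack{h,p\in\Sigma'\\ p=-h-g_0+\alpha}}\{\mathcal P_h,\mathcal P_p\}+\sum_{\substack{k,q\in\Sigma'\\ q=-k+\alpha}}\mathcal P_k\mathcal P_q.$$ *)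

theory Defs
  imports Complex_Main
begin

text \<open>
  A \<open>G\<close>-graded vector space is modelled by a vector space structure \<open>scale\<close> on the whole type
  \<open>'p\<close> together with a family \<open>P\<close> of subspaces indexed by the abelian group \<open>'g\<close>, of which
  \<open>'p\<close> is the internal direct sum. The sum of a family of subspaces is written as the span
  of its union.
\<close>

locale graded_vector_space = vector_space scale
  for scale :: "'k::field \<Rightarrow> 'p::ab_group_add \<Rightarrow> 'p" +
  fixes P :: "'g::ab_group_add \<Rightarrow> 'p set"
  assumes subspace_component: "subspace (P g)"
    and span_components: "span (\<Union>g. P g) = UNIV"
    and independent_components:
      "\<lbrakk>finite S; \<And>g. g \<in> S \<Longrightarrow> x g \<in> P g; (\<Sum>g\<in>S. x g) = 0; h \<in> S\<rbrakk> \<Longrightarrow> x h = 0"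

locale skew_symmetric_bicharacter =
  fixes eps :: "'g::ab_group_add \<Rightarrow> 'g \<Rightarrow> 'k::field"
  assumes eps_nonzero: "eps a b \<noteq> 0"
    and eps_skew: "eps a b = inverse (eps b a)"
    and eps_add_right: "eps a (b + c) = eps a b * eps a c"

locale poisson_color_algebra =
  graded_vector_space scale P + skew_symmetric_bicharacter eps
  for scale :: "'k::field \<Rightarrow> 'p::ab_group_add \<Rightarrow> 'p"
    and P :: "'g::ab_group_add \<Rightarrow> 'p set"
    and eps :: "'g \<Rightarrow> 'g \<Rightarrow> 'k" +
  fixes g0 :: 'g
    and br :: "'p \<Rightarrow> 'p \<Rightarrow> 'p"
    and mul :: "'p \<Rightarrow> 'p \<Rightarrow> 'p"
  assumes br_linear_right: "Vector_Spaces.linear scale scale (\<lambda>y. br x y)"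
    and br_linear_left: "Vector_Spaces.linear scale scale (\<lambda>x. br x y)"
    and br_degree: "\<lbrakk>x \<in> P g; y \<in> P h\<rbrakk> \<Longrightarrow> br x y \<in> P (g + h + g0)"
    and br_skew: "\<lbrakk>x \<in> P g; y \<in> P h\<rbrakk> \<Longrightarrow> br x y = - scale (eps (g + g0) (h + g0)) (br y x)"
    and br_jacobi: "\<lbrakk>x \<in> P g; y \<in> P h; z \<in> P k\<rbrakk> \<Longrightarrow>
      br x (br y z) = br (br x y) z + scale (eps (g + g0) (h + g0)) (br y (br x z))"
    and mul_linear_right: "Vector_Spaces.linear scale scale (\<lambda>y. mul x y)"
    and mul_linear_left: "Vector_Spaces.linear scale scale (\<lambda>x. mul x y)"
    and mul_assoc: "mul (mul x y) z = mul x (mul y z)"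
    and mul_degree: "\<lbrakk>x \<in> P g; y \<in> P h\<rbrakk> \<Longrightarrow> mul x y \<in> P (g + h)"
    and mul_commute: "\<lbrakk>x \<in> P g; y \<in> P h\<rbrakk> \<Longrightarrow> mul x y = scale (eps g h) (mul y x)"
    and br_leibniz: "\<lbrakk>x \<in> P g; y \<in> P h; z \<in> P k\<rbrakk> \<Longrightarrow>
      br x (mul y z) = mul (br x y) z + scale (eps (g + g0) h) (mul y (br x z))"

definition prod_span ::
  "('k::field \<Rightarrow> 'p::ab_group_add \<Rightarrow> 'p) \<Rightarrow> ('p \<Rightarrow> 'p \<Rightarrow> 'p) \<Rightarrow> 'p set \<Rightarrow> 'p set \<Rightarrow> 'p set"
  where "prod_span scale f A B = module.span scale {f a b | a b. a \<in> A \<and> b \<in> B}"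

definition graded_subspace ::
  "('k::field \<Rightarrow> 'p::ab_group_add \<Rightarrow> 'p) \<Rightarrow> ('g \<Rightarrow> 'p set) \<Rightarrow> 'p set \<Rightarrow> bool"
  where "graded_subspace scale P Q \<longleftrightarrow>
    module.subspace scale Q \<and> Q = module.span scale (\<Union>g. Q \<inter> P g)"

definition poisson_subalgebra ::
  "('k::field \<Rightarrow> 'p::ab_group_add \<Rightarrow> 'p) \<Rightarrow> ('g \<Rightarrow> 'p set) \<Rightarrow> ('p \<Rightarrow> 'p \<Rightarrow> 'p) \<Rightarrow>
    ('p \<Rightarrow> 'p \<Rightarrow> 'p) \<Rightarrow> 'p set \<Rightarrow> bool"
  where "poisson_subalgebra scale P br mul Q \<longleftrightarrow>
    graded_subspace scale P Q \<and>
    prod_span scale br Q Q \<subseteq> Q \<and> prod_span scale mul Q Q \<subseteq> Q"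

definition poisson_ideal ::
  "('k::field \<Rightarrow> 'p::ab_group_add \<Rightarrow> 'p) \<Rightarrow> ('g \<Rightarrow> 'p set) \<Rightarrow> ('p \<Rightarrow> 'p \<Rightarrow> 'p) \<Rightarrow>
    ('p \<Rightarrow> 'p \<Rightarrow> 'p) \<Rightarrow> 'p set \<Rightarrow> bool"
  where "poisson_ideal scale P br mul I \<longleftrightarrow>
    poisson_subalgebra scale P br mul I \<and>
    prod_span scale br I UNIV \<subseteq> I \<and> prod_span scale br UNIV I \<subseteq> I \<and>
    prod_span scale mul I UNIV \<subseteq> I \<and> prod_span scale mul UNIV I \<subseteq> I"

definition simple_poisson ::
  "('k::field \<Rightarrow> 'p::ab_group_add \<Rightarrow> 'p) \<Rightarrow> ('g \<Rightarrow> 'p set) \<Rightarrow> ('p \<Rightarrow> 'p \<Rightarrow> 'p) \<Rightarrow>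
    ('p \<Rightarrow> 'p \<Rightarrow> 'p) \<Rightarrow> bool"
  where "simple_poisson scale P br mul \<longleftrightarrow>
    prod_span scale br UNIV UNIV \<noteq> {0} \<and> prod_span scale mul UNIV UNIV \<noteq> {0} \<and>
    (\<forall>I. poisson_ideal scale P br mul I \<longrightarrow> I = {0} \<or> I = UNIV)"

definition restricted_support ::
  "('g::ab_group_add \<Rightarrow> 'p::ab_group_add set) \<Rightarrow> 'g \<Rightarrow> 'g set"
  where "restricted_support P g0 = {g. P g \<noteq> {0}} - {0, g0, - g0}"

definition pm_support ::
  "('g::ab_group_add \<Rightarrow> 'p::ab_group_add set) \<Rightarrow> 'g \<Rightarrow> 'g set"
  where "pm_support P g0 = restricted_support P g0 \<union> uminus ` restricted_support P g0"

text \<open>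
  Only the values \<open>gs 1, \<dots>, gs n\<close> and \<open>ks 2, \<dots>, ks n\<close> matter. For \<open>n = 1\<close> all
  ranges starting at \<open>2\<close> are empty and the condition reads \<open>g \<in> {h, - h}\<close>.
\<close>

definition connected_to ::
  "('g::ab_group_add \<Rightarrow> 'p::ab_group_add set) \<Rightarrow> 'g \<Rightarrow> 'g \<Rightarrow> 'g \<Rightarrow> bool"
  where "connected_to P g0 g h \<longleftrightarrow>
    (\<exists>(n::nat) gs ks. n \<ge> 1 \<and>
      (\<forall>i\<in>{1..n}. gs i \<in> pm_support P g0 \<union> {0, g0, - g0}) \<and>
      (\<forall>i\<in>{2..n}. ks i \<in> {0, g0, - g0}) \<and>
      gs 1 = g \<and>
      (\<forall>m\<in>{2..n - 1}. gs 1 + (\<Sum>i = 2..m. gs i + ks i) \<in> pm_support P g0) \<and>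
      gs 1 + (\<Sum>i = 2..n. gs i + ks i) \<in> {h, - h})"

definition connection_class ::
  "('g::ab_group_add \<Rightarrow> 'p::ab_group_add set) \<Rightarrow> 'g \<Rightarrow> 'g \<Rightarrow> 'g set"
  where "connection_class P g0 g = {h \<in> restricted_support P g0. connected_to P g0 g h}"

definition class_component ::
  "('k::field \<Rightarrow> 'p::ab_group_add \<Rightarrow> 'p) \<Rightarrow> ('g::ab_group_add \<Rightarrow> 'p set) \<Rightarrow> 'g \<Rightarrow>
    ('p \<Rightarrow> 'p \<Rightarrow> 'p) \<Rightarrow> ('p \<Rightarrow> 'p \<Rightarrow> 'p) \<Rightarrow> 'g \<Rightarrow> 'g \<Rightarrow> 'p set"
  where "class_component scale P g0 br mul \<alpha> g = module.span scale
    (\<Union>{prod_span scale br (P h) (P p) | h p.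
        h \<in> connection_class P g0 g \<and> p \<in> restricted_support P g0 \<and> p = - h - g0 + \<alpha>} \<union>
     \<Union>{prod_span scale mul (P k) (P q) | k q.
        k \<in> connection_class P g0 g \<and> q \<in> restricted_support P g0 \<union> {- g0} \<and> q = - k + \<alpha>})"

definition class_space ::
  "('k::field \<Rightarrow> 'p::ab_group_add \<Rightarrow> 'p) \<Rightarrow> ('g::ab_group_add \<Rightarrow> 'p set) \<Rightarrow> 'g \<Rightarrow> 'g \<Rightarrow> 'p set"
  where "class_space scale P g0 g = module.span scale (\<Union>h\<in>connection_class P g0 g. P h)"

text \<open>
  The outer sum below is direct without further hypotheses: the first summand lies in degrees
  \<open>0, g0, - g0\<close>, none of which belongs to the restricted support.
\<close>

definition class_ideal ::
  "('k::field \<Rightarrow> 'p::ab_group_add \<Rightarrow> 'p) \<Rightarrow> ('g::ab_group_add \<Rightarrow> 'p set) \<Rightarrow> 'g \<Rightarrow>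
    ('p \<Rightarrow> 'p \<Rightarrow> 'p) \<Rightarrow> ('p \<Rightarrow> 'p \<Rightarrow> 'p) \<Rightarrow> 'g \<Rightarrow> 'p set"
  where "class_ideal scale P g0 br mul g = module.span scale
    ((\<Union>\<alpha>\<in>{0, g0, - g0}. class_component scale P g0 br mul \<alpha> g) \<union> class_space scale P g0 g)"

definition tight ::
  "('k::field \<Rightarrow> 'p::ab_group_add \<Rightarrow> 'p) \<Rightarrow> ('g::ab_group_add \<Rightarrow> 'p set) \<Rightarrow> 'g \<Rightarrow>
    ('p \<Rightarrow> 'p \<Rightarrow> 'p) \<Rightarrow> ('p \<Rightarrow> 'p \<Rightarrow> 'p) \<Rightarrow> 'g \<Rightarrow> bool"
  where "tight scale P g0 br mul \<alpha> \<longleftrightarrow>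
    (let S = restricted_support P g0 -
           {g0 + g0, - (g0 + g0), g0 + g0 + g0, - (g0 + g0 + g0)}
     in P \<alpha> = module.span scale
       (\<Union>{prod_span scale br (P h) (P p) | h p. h \<in> S \<and> p \<in> S \<and> p = - h - g0 + \<alpha>} \<union>
        \<Union>{prod_span scale mul (P k) (P q) | k q. k \<in> S \<and> q \<in> S \<and> q = - k + \<alpha>}))"

end

theory Submission
  imports Defs
begin

text \<open>
  Everything rests on multiplying \<open>P h\<close>, \<open>h \<in> [g]\<close>, by an arbitrary component \<open>P p\<close>. Such a
  product can fail to be of the required form only if \<open>p\<close> and the degree of the product both lie
  in \<open>{0, g0, - g0}\<close>, which forces \<open>h\<close> to be \<open>\<plusminus>2g0\<close> or \<open>-3g0\<close>. Tightness then
  writes \<open>P p\<close> through components of degrees different from \<open>\<plusminus>2g0\<close> and \<open>\<plusminus>3g0\<close>, and the Jacobi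
  and Leibniz identities move the factor from \<open>P h\<close> onto these without leaving \<open>[g]\<close>.
  A second application of the identities treats the products lying in degrees \<open>{0, g0, - g0}\<close>.
\<close>

section \<open>Prolonging connections by one step\<close>

lemma pm_support_uminus: "t \<in> pm_support P g0 \<Longrightarrow> - t \<in> pm_support P g0"
  by (auto simp: pm_support_def image_iff)

lemma connected_to_refl: "g \<in> restricted_support P g0 \<Longrightarrow> connected_to P g0 g g"
  unfolding connected_to_def
  by (rule exI[of _ 1], rule exI[of _ "\<lambda>_. g"]) (auto simp: pm_support_def)

text \<open>Appending the summand \<open>t + k\<close> turns the old endpoint into an intermediate
  partial sum, which is why \<open>h\<close> has to lie in the support. All closure properties of
  the class of \<open>g\<close> come from this.\<close>

lemma connected_to_step:
  assumes gh: "connected_to P g0 g h" and h: "h \<in> restricted_support P g0"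
    and t: "t \<in> pm_support P g0 \<union> {0, g0, - g0}" and k: "k \<in> {0, g0, - g0}"
    and h': "h + t + k \<in> {h', - h'}"
  shows "connected_to P g0 g h'"
proof -
  from gh obtain n gs ks where n: "n \<ge> (1::nat)"
    and gs: "\<forall>i\<in>{1..n}. gs i \<in> pm_support P g0 \<union> {0, g0, - g0}"
    and ks: "\<forall>i\<in>{2..n}. ks i \<in> {0, g0, - g0}"
    and g1: "gs 1 = g"
    and part: "\<forall>m\<in>{2..n - 1}. gs 1 + (\<Sum>i = 2..m. gs i + ks i) \<in> pm_support P g0"
    and last: "gs 1 + (\<Sum>i = 2..n. gs i + ks i) \<in> {h, - h}"
    unfolding connected_to_def by blast
  define s where "s = gs 1 + (\<Sum>i = 2..n. gs i + ks i)"
  \<comment> \<open>If the chain ends in \<open>-h\<close>, it is prolonged by the opposite step.\<close>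
  obtain t' k' where t': "t' \<in> pm_support P g0 \<union> {0, g0, - g0}"
    and k': "k' \<in> {0, g0, - g0}" and end': "s + (t' + k') \<in> {h', - h'}"
  proof (cases "s = h")
    case True
    with t k h' show ?thesis by (intro that[of t k]) (auto simp: add.assoc)
  next
    case False
    with last have s: "s = - h" by (simp add: s_def)
    have "s + (- t + - k) = - (h + t + k)" by (simp add: s)
    then have "s + (- t + - k) \<in> {h', - h'}"
      using h' by (metis insert_iff empty_iff minus_minus)
    moreover have "- t \<in> pm_support P g0 \<union> {0, g0, - g0}"
      using t pm_support_uminus[of t P g0] by auto
    ultimately show ?thesis using k by (intro that[of "- t" "- k"]) auto
  qed
  define gs' where "gs' = gs(Suc n := t')"
  define ks' where "ks' = ks(Suc n := k')"
  have cong: "(\<Sum>i = 2..m. gs' i + ks' i) = (\<Sum>i = 2..m. gs i + ks i)" if "m \<le> n" for m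
    using that by (intro sum.cong) (auto simp: gs'_def ks'_def)
  have g1': "gs' 1 = gs 1" using n by (simp add: gs'_def)
  have s_pm: "s \<in> pm_support P g0"
    using last h by (auto simp: s_def pm_support_def)
  have part': "gs' 1 + (\<Sum>i = 2..m. gs' i + ks' i) \<in> pm_support P g0" if "m \<in> {2..Suc n - 1}" for m
  proof (cases "m = n")
    case True
    then show ?thesis using s_pm cong[of n] g1' by (simp add: s_def)
  next
    case False
    then have "m \<in> {2..n - 1}" using that by auto
    then show ?thesis using part cong[of m] g1' by auto
  qed
  have "(\<Sum>i = 2..Suc n. gs' i + ks' i) = (\<Sum>i = 2..n. gs' i + ks' i) + (t' + k')"
    using n by (simp add: gs'_def ks'_def)
  then have "gs' 1 + (\<Sum>i = 2..Suc n. gs' i + ks' i) = s + (t' + k')"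
    using cong[of n] g1' by (simp add: s_def add.assoc)
  then have last': "gs' 1 + (\<Sum>i = 2..Suc n. gs' i + ks' i) \<in> {h', - h'}"
    using end' by simp
  have "\<forall>i\<in>{1..Suc n}. gs' i \<in> pm_support P g0 \<union> {0, g0, - g0}"
    using gs t' by (auto simp: gs'_def)
  moreover have "\<forall>i\<in>{2..Suc n}. ks' i \<in> {0, g0, - g0}"
    using ks k' by (auto simp: ks'_def)
  ultimately show ?thesis
    unfolding connected_to_def using part' last' g1 g1'
    by (intro exI[of _ "Suc n"] exI[of _ gs'] exI[of _ ks']) auto
qed

section \<open>Linear algebra in a graded vector space\<close>

context graded_vector_space
begin

lemma zero_in_component: "0 \<in> P g"
  using subspace_component by (rule subspace_0)

lemma component_restricted_support:
  "\<lbrakk>x \<in> P g; x \<noteq> 0; g \<notin> {0, g0, - g0}\<rbrakk> \<Longrightarrow> g \<in> restricted_support P g0"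
  by (auto simp: restricted_support_def)

text \<open>Collecting terms of equal degree gives one summand per degree, the form in which
  \<open>independent_components\<close> applies.\<close>

lemma span_components_sum:
  assumes "x \<in> span (\<Union>k\<in>S. P k)"
  shows "\<exists>T y. finite T \<and> T \<subseteq> S \<and> (\<forall>k\<in>T. y k \<in> P k) \<and> x = (\<Sum>k\<in>T. y k)"
  using assms
proof (induction rule: span_induct_alt)
  case base
  show ?case by (rule exI[of _ "{}"]) auto
next
  case (step c v w)
  then obtain T y k where T: "finite T" "T \<subseteq> S" "\<forall>k\<in>T. y k \<in> P k" "w = (\<Sum>k\<in>T. y k)"
    and k: "k \<in> S" "v \<in> P k" by auto
  \<comment> \<open>The values of \<open>y\<close> outside \<open>T\<close> are arbitrary, so they
    are reset to 0; this treats the cases \<open>k \<in> T\<close> and \<open>k \<notin> T\<close>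
    alike.\<close>
  define y' where "y' = (\<lambda>j. if j \<in> T then y j else 0)"
  define y'' where "y'' = (\<lambda>j. y' j + (if j = k then scale c v else 0))"
  have "(\<Sum>j\<in>insert k T. y' j) = w"
    using T by (auto simp: y'_def sum.If_cases Int_absorb1 subset_insertI)
  then have "scale c v + w = (\<Sum>j\<in>insert k T. y'' j)"
    using T(1) by (simp add: y''_def sum.distrib sum.delta)
  moreover have "\<forall>j\<in>insert k T. y'' j \<in> P j"
    using T k subspace_component zero_in_component
    by (auto simp: y''_def y'_def intro!: subspace_add subspace_scale)
  ultimately show ?case
    using T k by (intro exI[of _ "insert k T"] exI[of _ y'']) auto
qed

text \<open>Putting \<open>- x\<close> in degree \<open>h\<close> next to a decomposition of
  \<open>x\<close> over degrees in \<open>S\<close> gives a vanishing sum, and independence kills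
  every term.\<close>

lemma component_Int_span:
  assumes x: "x \<in> P h" "x \<in> span (\<Union>k\<in>S. P k)" and h: "h \<notin> S"
  shows "x = 0"
proof -
  from span_components_sum[OF x(2)] obtain T y where
    T: "finite T" "T \<subseteq> S" "\<forall>k\<in>T. y k \<in> P k" "x = (\<Sum>k\<in>T. y k)" by blast
  have hT: "h \<notin> T" using T(2) h by auto
  define z where "z = y(h := - x)"
  have "(\<Sum>k\<in>T. z k) = x" using T(4) hT by (auto simp: z_def intro: sum.cong)
  then have "(\<Sum>k\<in>insert h T. z k) = 0"
    using hT T(1) by (simp add: z_def)
  moreover have "z k \<in> P k" if "k \<in> insert h T" for k
    using that T(3) x(1) subspace_component by (auto simp: z_def subspace_neg)
  ultimately have "z h = 0"
    using T(1) independent_components[of "insert h T" z h] by auto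
  then show ?thesis by (simp add: z_def)
qed

lemma prod_span_subset:
  assumes "subspace I" "\<And>a b. \<lbrakk>a \<in> A; b \<in> B\<rbrakk> \<Longrightarrow> f a b \<in> I"
  shows "prod_span scale f A B \<subseteq> I"
  unfolding prod_span_def using assms by (intro span_minimal) auto

lemma prod_span_memI: "\<lbrakk>a \<in> A; b \<in> B\<rbrakk> \<Longrightarrow> f a b \<in> prod_span scale f A B"
  unfolding prod_span_def by (rule span_base) auto

text \<open>The preimage of a subspace is a subspace. Applied to multiplication by a fixed element,
  this reduces every absorption claim to spanning elements.\<close>

lemma linear_vimage_span:
  assumes f: "Vector_Spaces.linear scale scale f" and I: "subspace I"
    and B: "\<And>b. b \<in> B \<Longrightarrow> f b \<in> I" and x: "x \<in> span B"
  shows "f x \<in> I"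
proof -
  interpret f: Vector_Spaces.linear scale scale f by (rule f)
  show ?thesis using x
  proof (induction rule: span_induct_alt)
    case base show ?case using I by (simp add: f.zero subspace_0)
  next
    case (step c v w)
    then show ?case using I B by (simp add: f.add f.scale subspace_add subspace_scale)
  qed
qed

end

section \<open>The class \<open>C\<close>, the span \<open>I\<close>, and the closure of
  \<open>C\<close> under adding degrees\<close>

locale tight_poisson_class =
  poisson_color_algebra scale P eps g0 br mul
  for scale :: "'k::field \<Rightarrow> 'p::ab_group_add \<Rightarrow> 'p"
    and P :: "'g::ab_group_add \<Rightarrow> 'p set" and eps g0 br mul +
  fixes g :: 'g
  assumes tight: "\<alpha> \<in> {0, g0, - g0} \<Longrightarrow> tight scale P g0 br mul \<alpha>"
    and g_support: "g \<in> restricted_support P g0"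
begin

definition "S = restricted_support P g0"
definition "D = {0, g0, - g0}"
definition "C = connection_class P g0 g"
definition "S' = S - {g0 + g0, - (g0 + g0), g0 + g0 + g0, - (g0 + g0 + g0)}"

text \<open>A plain union, not a span: its elements are homogeneous with degree in \<open>C\<close>,
  so the graded identities apply to them directly.\<close>

definition "U = (\<Union>h\<in>C. P h)"
definition "gens = U \<union>
  {br x y | x y h p. h \<in> C \<and> p \<in> C \<and> h + p + g0 \<in> D \<and> x \<in> P h \<and> y \<in> P p} \<union>
  {mul x y | x y h p. h \<in> C \<and> p \<in> C \<and> h + p \<in> D \<and> x \<in> P h \<and> y \<in> P p}"
definition "I = span gens"

lemma C_subset: "h \<in> C \<Longrightarrow> h \<in> S"
  by (simp add: C_def S_def connection_class_def)

lemma S_disjoint: "h \<in> S \<Longrightarrow> h \<notin> D"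
  by (simp add: S_def D_def restricted_support_def)

lemma g_in_C: "g \<in> C"
  using g_support by (simp add: C_def connection_class_def connected_to_refl)

lemma C_step:
  assumes "h \<in> C" "t \<in> S \<union> D \<or> - t \<in> S \<union> D" "k \<in> D" "h' \<in> S" "h + t + k \<in> {h', - h'}"
  shows "h' \<in> C"
proof -
  have "u \<in> pm_support P g0 \<union> {0, g0, - g0}" "- u \<in> pm_support P g0 \<union> {0, g0, - g0}"
    if "u \<in> S \<union> D" for u
    using that by (auto simp: S_def D_def pm_support_def)
  from this[of t] this[of "- t"] have "t \<in> pm_support P g0 \<union> {0, g0, - g0}"
    using assms(2) by (metis minus_minus)
  then show ?thesis
    using assms connected_to_step[of P g0 g h t k h']
    by (simp add: C_def S_def D_def connection_class_def)
qed

lemma D_simps: "0 \<in> D" "g0 \<in> D" "- g0 \<in> D"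
  by (simp_all add: D_def)

lemma D_uminus: "d \<in> D \<Longrightarrow> - d \<in> D"
  by (auto simp: D_def)

lemma C_add_g0:
  assumes "h \<in> C" "p \<in> S \<union> D" "h + p + g0 \<in> S" shows "h + p + g0 \<in> C"
  using C_step[of h p g0 "h + p + g0"] assms D_simps by auto

lemma C_add:
  assumes "h \<in> C" "p \<in> S \<union> D" "h + p \<in> S" shows "h + p \<in> C"
  using C_step[of h p 0 "h + p"] assms D_simps by auto

text \<open>Starting at \<open>h\<close>, adding \<open>g0\<close> and subtracting the degree
  \<open>h + p + g0\<close>, itself in \<open>D\<close>, leads to \<open>- p\<close>, and a
  connection to \<open>p\<close> may end there.\<close>

lemma C_partner_g0:
  assumes "h \<in> C" "p \<in> S" "h + p + g0 \<in> D" shows "p \<in> C"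
  using C_step[of h g0 "- (h + p + g0)" p] assms D_simps D_uminus[of "h + p + g0"] by simp

lemma C_partner:
  assumes "h \<in> C" "p \<in> S" "h + p \<in> D" shows "p \<in> C"
  using C_step[of h 0 "- (h + p)" p] assms D_simps D_uminus[of "h + p"] by simp

lemma subspace_I: "subspace I"
  by (simp add: I_def)

lemma U_I: "x \<in> U \<Longrightarrow> x \<in> I"
  unfolding I_def gens_def by (rule span_base) auto

lemma zero_in_U: "0 \<in> U"
  using g_in_C zero_in_component by (auto simp: U_def)

lemma nonlow_in_S: "\<lbrakk>x \<in> P h; h \<notin> D\<rbrakk> \<Longrightarrow> x = 0 \<or> h \<in> S"
  using component_restricted_support[of x h g0] by (auto simp: S_def D_def)

lemma br_zero: "br x 0 = 0" "br 0 x = 0"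
  using br_linear_right[of x] br_linear_left[of x]
  by (auto simp: Vector_Spaces.linear_def dest: module_hom.zero)

lemma mul_zero: "mul x 0 = 0" "mul 0 x = 0"
  using mul_linear_right[of x] mul_linear_left[of x]
  by (auto simp: Vector_Spaces.linear_def dest: module_hom.zero)

section \<open>Products of \<open>U\<close> with components in the support\<close>

lemma br_swap_I:
  assumes "x \<in> P h" "y \<in> P p" "br x y \<in> I" shows "br y x \<in> I"
  using br_skew[OF assms(2,1)] assms(3) subspace_I by (simp add: subspace_neg subspace_scale)

lemma mul_swap_I:
  assumes "x \<in> P h" "y \<in> P p" "mul x y \<in> I" shows "mul y x \<in> I"
  using mul_commute[OF assms(2,1)] assms(3) subspace_I by (simp add: subspace_scale)

text \<open>A product of degree outside \<open>D\<close> either vanishes or has its degree in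
  \<open>S\<close>; in the second case one step from \<open>h\<close> reaches that degree.\<close>

lemma br_in_U:
  assumes "h \<in> C" "x \<in> P h" "p \<in> S \<union> D" "y \<in> P p" "h + p + g0 \<notin> D"
  shows "br x y \<in> U"
  using nonlow_in_S[OF br_degree[OF assms(2,4)] assms(5)] C_add_g0[OF assms(1,3)]
    br_degree[OF assms(2,4)] zero_in_U by (auto simp: U_def)

lemma mul_in_U:
  assumes "h \<in> C" "x \<in> P h" "p \<in> S \<union> D" "y \<in> P p" "h + p \<notin> D"
  shows "mul x y \<in> U"
  using nonlow_in_S[OF mul_degree[OF assms(2,4)] assms(5)] C_add[OF assms(1,3)]
    mul_degree[OF assms(2,4)] zero_in_U by (auto simp: U_def)

text \<open>If the product falls into a degree of \<open>D\<close>, then \<open>p\<close> is itself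
  in \<open>C\<close> and the product is a generator.\<close>

lemma br_support_I:
  assumes "x \<in> U" "p \<in> S" "y \<in> P p"
  shows "br x y \<in> I" "br y x \<in> I"
proof -
  from assms(1) obtain h where h: "h \<in> C" "x \<in> P h" by (auto simp: U_def)
  show "br x y \<in> I"
  proof (cases "h + p + g0 \<in> D")
    case True
    then have "br x y \<in> gens"
      using h assms C_partner_g0[OF h(1) assms(2)] by (auto simp: gens_def)
    then show ?thesis by (simp add: I_def span_base)
  next
    case False
    then show ?thesis using br_in_U[OF h _ assms(3)] assms(2) U_I by auto
  qed
  then show "br y x \<in> I" using br_swap_I h(2) assms(3) by blast
qed

lemma mul_support_I:
  assumes "x \<in> U" "p \<in> S" "y \<in> P p"
  shows "mul x y \<in> I" "mul y x \<in> I"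
proof -
  from assms(1) obtain h where h: "h \<in> C" "x \<in> P h" by (auto simp: U_def)
  show "mul x y \<in> I"
  proof (cases "h + p \<in> D")
    case True
    then have "mul x y \<in> gens"
      using h assms C_partner[OF h(1) assms(2)] by (auto simp: gens_def)
    then show ?thesis by (simp add: I_def span_base)
  next
    case False
    then show ?thesis using mul_in_U[OF h _ assms(3)] assms(2) U_I by auto
  qed
  then show "mul y x \<in> I" using mul_swap_I h(2) assms(3) by blast
qed

text \<open>Tightness in usable form: for \<open>f\<close> a multiplication by \<open>x\<close>, the
  factor \<open>y\<close> of degree in \<open>D\<close> may be replaced by products of two elements
  with degrees in \<open>S'\<close>.\<close>

lemma tight_linear_image:
  assumes p: "p \<in> D" and y: "y \<in> P p"
    and f: "Vector_Spaces.linear scale scale f"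
    and b: "\<And>i j a b. \<lbrakk>i \<in> S'; j \<in> S'; i + j + g0 = p; a \<in> P i; b \<in> P j\<rbrakk> \<Longrightarrow> f (br a b) \<in> I"
    and m: "\<And>i j a b. \<lbrakk>i \<in> S'; j \<in> S'; i + j = p; a \<in> P i; b \<in> P j\<rbrakk> \<Longrightarrow> f (mul a b) \<in> I"
  shows "f y \<in> I"
proof -
  have inner: "f z \<in> I" if "z \<in> prod_span scale F (P i) (P j)"
    "\<And>a b. \<lbrakk>a \<in> P i; b \<in> P j\<rbrakk> \<Longrightarrow> f (F a b) \<in> I" for z F i j
    using that(2) by (auto intro: linear_vimage_span[OF f subspace_I _ that(1)[unfolded prod_span_def]])
  have "y \<in> span
       (\<Union>{prod_span scale br (P h) (P q) | h q. h \<in> S' \<and> q \<in> S' \<and> q = - h - g0 + p} \<union>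
        \<Union>{prod_span scale mul (P k) (P q) | k q. k \<in> S' \<and> q \<in> S' \<and> q = - k + p})"
    using y tight[OF p[unfolded D_def]]
    unfolding tight_def Let_def S'_def S_def by (rule subst[rotated])
  then show ?thesis
  proof (rule linear_vimage_span[OF f subspace_I, rotated])
    fix z assume "z \<in> \<Union>{prod_span scale br (P h) (P q) | h q.
            h \<in> S' \<and> q \<in> S' \<and> q = - h - g0 + p} \<union>
        \<Union>{prod_span scale mul (P k) (P q) | k q. k \<in> S' \<and> q \<in> S' \<and> q = - k + p}"
    then consider
      (b) i j where "i \<in> S'" "j \<in> S'" "j = - i - g0 + p" "z \<in> prod_span scale br (P i) (P j)"
      | (m) i j where "i \<in> S'" "j \<in> S'" "j = - i + p" "z \<in> prod_span scale mul (P i) (P j)"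
      by blast
    then show "f z \<in> I"
    proof cases
      case b
      have "i + j + g0 = p" using b(3) by (simp add: algebra_simps)
      then show ?thesis using inner[OF b(4)] assms(4)[OF b(1,2)] by blast
    next
      case m
      have "i + j = p" using m(3) by (simp add: algebra_simps)
      then show ?thesis using inner[OF m(4)] assms(5)[OF m(1,2)] by blast
    qed
  qed
qed

lemma S'_S: "i \<in> S' \<Longrightarrow> i \<in> S"
  by (simp add: S'_def)

lemma S'_simps:
  assumes "i \<in> S'"
  shows "i \<noteq> 0" "i \<noteq> g0" "i \<noteq> - g0" "i \<noteq> g0 + g0" "i \<noteq> - g0 - g0"
    "i \<noteq> g0 + g0 + g0" "i \<noteq> - g0 - g0 - g0"
  using assms S_disjoint[OF S'_S[OF assms]] by (auto simp: S'_def D_def algebra_simps)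

section \<open>Products of \<open>U\<close> with components of degree in \<open>D\<close>\<close>

lemma br_low_I:
  assumes h: "h \<in> C" "x \<in> P h" and p: "p \<in> D" "y \<in> P p"
  shows "br x y \<in> I"
proof (cases "h + p + g0 \<in> D")
  case False
  then show ?thesis using br_in_U[OF h _ p(2)] p(1) U_I by auto
next
  case True
  have h0: "h \<notin> D" using h(1) C_subset S_disjoint by blast
  define d where "d = h + p + g0"
  have "h = d - p - g0" by (simp add: d_def)
  \<comment> \<open>A difference of two elements of \<open>D\<close> is a multiple of
    \<open>g0\<close> between -2 and 2; after subtracting \<open>g0\<close>, only these two values
    can avoid \<open>D\<close>.\<close>
  then have h23: "h = - g0 - g0 \<or> h = - g0 - g0 - g0"
    using True p(1) h0 unfolding d_def[symmetric] D_def by auto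
  \<comment> \<open>An offending \<open>i\<close> would be one of \<open>0\<close>,
    \<open>g0\<close>, \<open>2g0\<close>, \<open>3g0\<close>, all excluded by \<open>S'\<close>.
    Hence multiplying \<open>x\<close> by one tight factor stays in \<open>U\<close>, and the other
    factor is handled by the support case.\<close>
  have nd: "h + i + g0 \<notin> D" if i: "i \<in> S'" for i
  proof
    define e where "e = h + i + g0"
    assume "h + i + g0 \<in> D"
    then have "e \<in> D" "i = e - h - g0" by (simp_all add: e_def)
    then show False using h23 S'_simps[OF i] by (auto simp: D_def)
  qed
  have U: "br x a \<in> U" if "i \<in> S'" "a \<in> P i" for i a
    using br_in_U[OF h _ that(2) nd[OF that(1)]] S'_S[OF that(1)] by simp
  show ?thesis
  proof (rule tight_linear_image[OF p br_linear_right])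
    fix i j a b
    assume br: "i \<in> S'" "j \<in> S'" "i + j + g0 = p" "a \<in> P i" "b \<in> P j"
    have "br (br x a) b \<in> I" "br a (br x b) \<in> I"
      using br U S'_S br_support_I by blast+
    then show "br x (br a b) \<in> I"
      unfolding br_jacobi[OF h(2) br(4,5)]
      using subspace_I by (intro subspace_add subspace_scale) auto
  next
    fix i j a b
    assume mul: "i \<in> S'" "j \<in> S'" "i + j = p" "a \<in> P i" "b \<in> P j"
    have "mul (br x a) b \<in> I" "mul a (br x b) \<in> I"
      using mul U S'_S mul_support_I by blast+
    then show "br x (mul a b) \<in> I"
      unfolding br_leibniz[OF h(2) mul(4,5)]
      using subspace_I by (intro subspace_add subspace_scale) auto
  qed
qed

text \<open>Associativity settles \<open>mul x (mul a b)\<close>. For \<open>mul x (br a b)\<close>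
  the Leibniz rule for \<open>br a (mul x b)\<close> is solved for its last term, so both
  \<open>br a x\<close> and \<open>mul x b\<close> must be controlled.\<close>

lemma mul_low_I:
  assumes h: "h \<in> C" "x \<in> P h" and p: "p \<in> D" "y \<in> P p"
  shows "mul x y \<in> I"
proof (cases "h + p \<in> D")
  case False
  then show ?thesis using mul_in_U[OF h _ p(2)] p(1) U_I by auto
next
  case True
  have h0: "h \<notin> D" using h(1) C_subset S_disjoint by blast
  define d where "d = h + p"
  have "h = d - p" by (simp add: d_def)
  then have h2: "h = g0 + g0 \<and> p = - g0 \<or> h = - g0 - g0 \<and> p = g0"
    using True p(1) h0 unfolding d_def[symmetric] D_def by auto
  have nd: "h + i \<notin> D" if i: "i \<in> S'" for i
  proof
    define e where "e = h + i"
    assume "h + i \<in> D"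
    then have "e \<in> D" "i = e - h" by (simp_all add: e_def)
    then show False using h2 S'_simps[OF i] by (auto simp: D_def)
  qed
  have U: "mul x a \<in> U" if "i \<in> S'" "a \<in> P i" for i a
    using mul_in_U[OF h _ that(2) nd[OF that(1)]] S'_S[OF that(1)] by simp
  show ?thesis
  proof (rule tight_linear_image[OF p mul_linear_right])
    fix i j a b
    assume mul: "i \<in> S'" "j \<in> S'" "i + j = p" "a \<in> P i" "b \<in> P j"
    then show "mul x (mul a b) \<in> I"
      using U S'_S mul_support_I by (metis mul_assoc)
  next
    fix i j a b
    assume br: "i \<in> S'" "j \<in> S'" "i + j + g0 = p" "a \<in> P i" "b \<in> P j"
    note i = S'_simps[OF br(1)] and j = S'_simps[OF br(2)]
    interpret ml: Vector_Spaces.linear scale scale "\<lambda>z. mul z b"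
      by (rule mul_linear_left)
    \<comment> \<open>For \<open>h = 2g0\<close> the exceptional degree \<open>i = -4g0\<close> would give \<open>j = 2g0\<close>.\<close>
    have "h + i + g0 \<notin> D"
    proof
      define e where "e = h + i + g0"
      assume "h + i + g0 \<in> D"
      then have e: "e \<in> D" "i = e - h - g0" by (simp_all add: e_def)
      have j_eq: "j = p - g0 - i" using br(3) by (simp add: algebra_simps)
      from h2 show False
      proof (elim disjE conjE)
        assume hp: "h = g0 + g0" "p = - g0"
        have "e = - g0"
          using e i unfolding hp D_def by auto
        then have "i = - g0 - g0 - (g0 + g0)" unfolding e(2) hp by (simp add: algebra_simps)
        then show False using j j_eq unfolding hp by simp
      next
        assume hp: "h = - g0 - g0" "p = g0"
        then show False using e i by (auto simp: D_def)
      qed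
    qed
    then have xa: "br x a \<in> U"
      using br_in_U[OF h _ br(4)] S'_S[OF br(1)] by simp
    then have "mul (br x a) b \<in> I" using br S'_S mul_support_I by blast
    moreover have "br a x = - scale (eps (i + g0) (h + g0)) (br x a)"
      using br_skew[OF br(4) h(2)] .
    ultimately have 1: "mul (br a x) b \<in> I"
      using subspace_I by (simp add: ml.neg ml.scale subspace_neg subspace_scale)
    have 2: "br a (mul x b) \<in> I"
      using U[OF br(2,5)] br S'_S br_support_I by blast
    \<comment> \<open>Reading the Leibniz rule backwards requires dividing by this bicharacter
      value.\<close>
    define c where "c = eps (i + g0) h"
    have "c \<noteq> 0" by (simp add: c_def eps_nonzero)
    have "br a (mul x b) = mul (br a x) b + scale c (mul x (br a b))"
      unfolding c_def by (rule br_leibniz[OF br(4) h(2) br(5)])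
    then have "scale c (mul x (br a b)) = br a (mul x b) - mul (br a x) b" by simp
    then have "scale c (mul x (br a b)) \<in> I" using 1 2 subspace_I by (simp add: subspace_diff)
    then have "scale (inverse c) (scale c (mul x (br a b))) \<in> I"
      using subspace_I by (rule subspace_scale[rotated])
    then show "mul x (br a b) \<in> I" using \<open>c \<noteq> 0\<close> by simp
  qed
qed

section \<open>Absorption of arbitrary elements, first by \<open>U\<close> and then by
  \<open>I\<close>\<close>

lemma U_times_I:
  assumes x: "x \<in> U"
  shows "br x y \<in> I" "br y x \<in> I" "mul x y \<in> I" "mul y x \<in> I"
proof -
  from x obtain h where h: "h \<in> C" "x \<in> P h" by (auto simp: U_def)
  have y: "y \<in> span (\<Union>p. P p)" by (simp add: span_components)
  have hom: "br x z \<in> I \<and> mul x z \<in> I" if z: "z \<in> P p" for z p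
  proof (cases "p \<in> D")
    case True
    then show ?thesis using br_low_I mul_low_I h z by blast
  next
    case False
    from nonlow_in_S[OF z this] show ?thesis
      using br_support_I mul_support_I x z subspace_I
      by (auto simp: br_zero mul_zero subspace_0)
  qed
  then have hom': "br z x \<in> I \<and> mul z x \<in> I" if "z \<in> P p" for z p
    using that br_swap_I mul_swap_I h(2) by blast
  show "br x y \<in> I"
    using hom by (intro linear_vimage_span[OF br_linear_right subspace_I _ y]) auto
  show "br y x \<in> I"
    using hom' by (intro linear_vimage_span[OF br_linear_left subspace_I _ y]) auto
  show "mul x y \<in> I"
    using hom by (intro linear_vimage_span[OF mul_linear_right subspace_I _ y]) auto
  show "mul y x \<in> I"
    using hom' by (intro linear_vimage_span[OF mul_linear_left subspace_I _ y]) auto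
qed

text \<open>Homogeneity makes \<open>I\<close> graded and permits swapping factors; the bound on the
  degrees is what the simple case exploits.\<close>

lemma gens_homogeneous:
  assumes "v \<in> gens" obtains k where "k \<in> C \<union> D" "v \<in> P k"
  using assms unfolding gens_def U_def by (auto dest: br_degree mul_degree)

text \<open>The identities rewrite the product so that each term has \<open>x\<close> or
  \<open>y\<close> as an outer factor. Being in \<open>U\<close>, that factor absorbs whatever
  stands beside it, so no further case split on degrees arises.\<close>

lemma gens_times_component:
  assumes v: "v \<in> gens" and z: "z \<in> P k"
  shows "br v z \<in> I \<and> mul v z \<in> I"
proof -
  consider (U) "v \<in> U"
    | (br) x y h p where "v = br x y" "h \<in> C" "p \<in> C" "x \<in> P h" "y \<in> P p"
    | (mul) x y h p where "v = mul x y" "h \<in> C" "p \<in> C" "x \<in> P h" "y \<in> P p"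
    using v unfolding gens_def by blast
  then show ?thesis
  proof cases
    case U
    then show ?thesis using U_times_I by blast
  next
    case br
    have xy: "x \<in> U" "y \<in> U" using br by (auto simp: U_def)
    have "br (br x y) z = br x (br y z) - scale (eps (h + g0) (p + g0)) (br y (br x z))"
      using br_jacobi[OF br(4,5) z] by simp
    moreover have "mul (br x y) z = br x (mul y z) - scale (eps (h + g0) p) (mul y (br x z))"
      using br_leibniz[OF br(4,5) z] by simp
    ultimately show ?thesis
      unfolding br(1) using U_times_I xy subspace_I by (simp add: subspace_diff subspace_scale)
  next
    case mul
    have xy: "x \<in> U" "y \<in> U" using mul by (auto simp: U_def)
    \<comment> \<open>The Leibniz rule has the associative product in the second argument, so this
      order is treated first and then swapped.\<close>
    have "br z (mul x y) \<in> I"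
      unfolding br_leibniz[OF z mul(4,5)] using U_times_I xy subspace_I
      by (simp add: subspace_add subspace_scale)
    then have "br (mul x y) z \<in> I"
      using br_swap_I[OF z mul_degree[OF mul(4,5)]] by blast
    then show ?thesis
      unfolding mul(1) using U_times_I xy by (simp add: mul_assoc)
  qed
qed

lemma I_times:
  assumes v: "v \<in> I"
  shows "br v y \<in> I" "br y v \<in> I" "mul v y \<in> I" "mul y v \<in> I"
proof -
  have y: "y \<in> span (\<Union>p. P p)" by (simp add: span_components)
  have hom: "br w z \<in> I \<and> mul w z \<in> I \<and> br z w \<in> I \<and> mul z w \<in> I"
    if w: "w \<in> gens" and z: "z \<in> P p" for w z p
    using gens_times_component[OF w z] gens_homogeneous[OF w] br_swap_I mul_swap_I z by metis
  have gens: "br w y \<in> I" "br y w \<in> I" "mul w y \<in> I" "mul y w \<in> I" if w: "w \<in> gens" for w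
  proof -
    show "br w y \<in> I"
      using hom[OF w] by (intro linear_vimage_span[OF br_linear_right subspace_I _ y]) auto
    show "br y w \<in> I"
      using hom[OF w] by (intro linear_vimage_span[OF br_linear_left subspace_I _ y]) auto
    show "mul w y \<in> I"
      using hom[OF w] by (intro linear_vimage_span[OF mul_linear_right subspace_I _ y]) auto
    show "mul y w \<in> I"
      using hom[OF w] by (intro linear_vimage_span[OF mul_linear_left subspace_I _ y]) auto
  qed
  have v: "v \<in> span gens" using v by (simp add: I_def)
  show "br v y \<in> I" by (rule linear_vimage_span[OF br_linear_left subspace_I gens(1) v])
  show "br y v \<in> I" by (rule linear_vimage_span[OF br_linear_right subspace_I gens(2) v])
  show "mul v y \<in> I" by (rule linear_vimage_span[OF mul_linear_left subspace_I gens(3) v])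
  show "mul y v \<in> I" by (rule linear_vimage_span[OF mul_linear_right subspace_I gens(4) v])
qed

lemma poisson_ideal_I: "poisson_ideal scale P br mul I"
proof -
  have "span (\<Union>g. I \<inter> P g) \<subseteq> I"
    by (rule span_minimal[OF _ subspace_I]) auto
  moreover have "I \<subseteq> span (\<Union>g. I \<inter> P g)"
  proof -
    have "gens \<subseteq> (\<Union>g. I \<inter> P g)"
    proof
      fix v assume v: "v \<in> gens"
      then obtain k where "v \<in> P k" by (rule gens_homogeneous)
      moreover have "v \<in> I" unfolding I_def using v by (rule span_base)
      ultimately show "v \<in> (\<Union>g. I \<inter> P g)" by blast
    qed
    from span_mono[OF this] show ?thesis by (simp only: I_def)
  qed
  ultimately have "I = span (\<Union>g. I \<inter> P g)" by (rule equalityI[rotated])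
  then have "graded_subspace scale P I"
    unfolding graded_subspace_def by (intro conjI subspace_I)
  moreover have "prod_span scale br I A \<subseteq> I" "prod_span scale br A I \<subseteq> I"
    "prod_span scale mul I A \<subseteq> I" "prod_span scale mul A I \<subseteq> I" for A
    by (intro prod_span_subset[OF subspace_I]; erule I_times)+
  ultimately show ?thesis
    unfolding poisson_ideal_def poisson_subalgebra_def by blast
qed

section \<open>Identification of \<open>I\<close> with the class ideal, and the simple case\<close>

lemma class_component_subset: "class_component scale P g0 br mul \<alpha> g \<subseteq> I"
proof -
  have h: "x \<in> U" if "h \<in> connection_class P g0 g" "x \<in> P h" for h x
    using that by (auto simp: U_def C_def)
  \<comment> \<open>One factor in \<open>U\<close> suffices, whatever the other is; for
    \<open>mul\<close> this includes the second degree \<open>- g0\<close>.\<close>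
  have br: "prod_span scale br (P h) A \<subseteq> I" if "h \<in> connection_class P g0 g" for h A
    using that by (intro prod_span_subset[OF subspace_I] U_times_I(1) h)
  have mul: "prod_span scale mul (P h) A \<subseteq> I" if "h \<in> connection_class P g0 g" for h A
    using that by (intro prod_span_subset[OF subspace_I] U_times_I(3) h)
  show ?thesis
    unfolding class_component_def
  proof (rule span_minimal[OF _ subspace_I], rule Un_least; rule Union_least)
    fix X
    assume "X \<in> {prod_span scale br (P h) (P p) | h p. h \<in> connection_class P g0 g \<and>
      p \<in> restricted_support P g0 \<and> p = - h - g0 + \<alpha>}"
    then show "X \<subseteq> I" by (elim CollectE exE conjE) (simp only: br)
  next
    fix X
    assume "X \<in> {prod_span scale mul (P k) (P q) | k q. k \<in> connection_class P g0 g \<and>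
      q \<in> restricted_support P g0 \<union> {- g0} \<and> q = - k + \<alpha>}"
    then show "X \<subseteq> I" by (elim CollectE exE conjE) (simp only: mul)
  qed
qed

text \<open>For the inclusion of \<open>I\<close>, a product generator lies in the
  \<open>class_component\<close> whose index is the degree of that product.\<close>

lemma class_ideal_eq: "class_ideal scale P g0 br mul g = I"
proof
  have "class_space scale P g0 g \<subseteq> I"
    unfolding class_space_def using U_I by (intro span_minimal subspace_I) (auto simp: U_def C_def)
  then show "class_ideal scale P g0 br mul g \<subseteq> I"
    unfolding class_ideal_def using class_component_subset
    by (intro span_minimal subspace_I) blast
next
  let ?J = "class_ideal scale P g0 br mul g"
  have comp: "class_component scale P g0 br mul \<alpha> g \<subseteq> ?J" if "\<alpha> \<in> D" for \<alpha>
    unfolding class_ideal_def using that by (intro subsetI span_base) (auto simp: D_def)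
  have "v \<in> ?J" if v: "v \<in> gens" for v
  proof -
    consider (U) "v \<in> U"
      | (br) x y h p where "v = br x y" "h \<in> C" "p \<in> C" "h + p + g0 \<in> D" "x \<in> P h" "y \<in> P p"
      | (mul) x y h p where "v = mul x y" "h \<in> C" "p \<in> C" "h + p \<in> D" "x \<in> P h" "y \<in> P p"
      using v unfolding gens_def by blast
    then show ?thesis
    proof cases
      case U
      then have "v \<in> class_space scale P g0 g"
        unfolding class_space_def by (intro span_base) (auto simp: U_def C_def)
      then show ?thesis unfolding class_ideal_def by (intro span_base) auto
    next
      case br
      have p: "p = - h - g0 + (h + p + g0)" by (simp add: algebra_simps)
      have v: "v \<in> prod_span scale br (P h) (P p)"
        unfolding br(1) using br(5,6) by (rule prod_span_memI)
      have hp: "h \<in> connection_class P g0 g" "p \<in> restricted_support P g0"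
        using br(2,3) C_subset[of p] by (simp_all add: C_def S_def)
      have "v \<in> class_component scale P g0 br mul (h + p + g0) g"
        unfolding class_component_def
        by (rule span_base[OF UnI1[OF UnionI[OF _ v]]])
          (intro CollectI exI conjI, rule refl, (rule hp p UnI1[OF hp(2)])+)
      then show ?thesis using comp br by blast
    next
      case mul
      have p: "p = - h + (h + p)" by (simp add: algebra_simps)
      have v: "v \<in> prod_span scale mul (P h) (P p)"
        unfolding mul(1) using mul(5,6) by (rule prod_span_memI)
      have hp: "h \<in> connection_class P g0 g" "p \<in> restricted_support P g0"
        using mul(2,3) C_subset[of p] by (simp_all add: C_def S_def)
      have "v \<in> class_component scale P g0 br mul (h + p) g"
        unfolding class_component_def
        by (rule span_base[OF UnI2[OF UnionI[OF _ v]]])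
          (intro CollectI exI conjI, rule refl, (rule hp p UnI1[OF hp(2)])+)
      then show ?thesis using comp mul by blast
    qed
  qed
  moreover have "subspace ?J" by (simp add: class_ideal_def)
  ultimately show "I \<subseteq> ?J" unfolding I_def by (intro span_minimal) auto
qed

text \<open>The ideal \<open>I\<close> contains the nonzero component of degree \<open>g\<close>, so
  it is everything; yet its degrees are confined to \<open>C \<union> D\<close>, which leaves no
  room for a component outside.\<close>

lemma simple_imp_connected:
  assumes simple: "simple_poisson scale P br mul" and h: "h \<in> restricted_support P g0"
  shows "connected_to P g0 g h"
proof (rule ccontr)
  assume "\<not> connected_to P g0 g h"
  then have h_C: "h \<notin> C \<union> D"
    using S_disjoint[of h] h by (simp add: C_def S_def connection_class_def)
  obtain x where x: "x \<in> P g" "x \<noteq> 0"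
    using g_support zero_in_component by (auto simp: restricted_support_def)
  then have "x \<in> I" using g_in_C U_I by (auto simp: U_def)
  then have "I = UNIV" using simple poisson_ideal_I x(2) by (auto simp: simple_poisson_def)
  moreover have "I \<subseteq> span (\<Union>k\<in>C \<union> D. P k)"
    unfolding I_def using gens_homogeneous by (intro span_mono) blast
  ultimately have "P h \<subseteq> {0}" using component_Int_span[OF _ _ h_C] by auto
  then have "P h = {0}" using zero_in_component by auto
  then show False using h by (simp add: restricted_support_def)
qed

end

theorem theorem1:
  fixes scale :: "'k::field \<Rightarrow> 'p::ab_group_add \<Rightarrow> 'p"
    and P :: "'g::ab_group_add \<Rightarrow> 'p set"
    and eps :: "'g \<Rightarrow> 'g \<Rightarrow> 'k"
    and g0 :: 'g
    and br mul :: "'p \<Rightarrow> 'p \<Rightarrow> 'p"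
  assumes "\<forall>x::'g. x + x = 0 \<longrightarrow> x = 0"
    and "poisson_color_algebra scale P eps g0 br mul"
    and "\<forall>\<alpha>\<in>{0, g0, - g0}. tight scale P g0 br mul \<alpha>"
  shows "(\<forall>g\<in>restricted_support P g0.
            poisson_ideal scale P br mul (class_ideal scale P g0 br mul g)) \<and>
         (simple_poisson scale P br mul \<longrightarrow>
            (\<forall>g\<in>restricted_support P g0. \<forall>h\<in>restricted_support P g0. connected_to P g0 g h))"
proof -
  have loc: "tight_poisson_class scale P eps g0 br mul g" if "g \<in> restricted_support P g0" for g
    using assms(2,3) that
    by (auto simp: tight_poisson_class_def tight_poisson_class_axioms_def)
  show ?thesis
    using loc tight_poisson_class.poisson_ideal_I tight_poisson_class.class_ideal_eq
      tight_poisson_class.simple_imp_connected by metis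
qed

end
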